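(* Let $a,b,c$ be commuting indeterminates and let $D$ be the derivation of the polynomial ring $\mathbb{Q}[a,b,c]$ (a linear map satisfying $D(uv)=D(u)v+uD(v)$) determined by $D(a)=ab$, $D(b)=b^2c$, $D(c)=bc^2$. For $n\ge 0$ let $y_n(x)=\sum_{k=0}^n\frac{(n+k)!}{(n-k)!\,k!}\left(\frac{x}{2}\right)^k$ be the Bessel polynomials. Then for all $n\geq 0$, $$D^n(ab)=ab^{n+1}y_n(c).$$
   Context: This is the formal derivative associated with the context-free grammar $G=\{a\rightarrow ab,\ b\rightarrow b^2c,\ c\rightarrow bc^2\}$: $D$ replaces each letter by its image under the grammar and extends to products by the Leibniz rule. $D^0$ is the identity. *)

theory Defs
  imports "HOL-Library.Poly_Mapping" "HOL-Computational_Algebra.Polynomial"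
begin

text \<open>
  The polynomial ring over \<open>'k\<close> in commuting indeterminates \<open>'v\<close>: finitely supported functions
  from monomials (finitely supported exponent vectors) to coefficients, with the
  convolution product of \<^theory>\<open>HOL-Library.Poly_Mapping\<close>.
\<close>

type_synonym ('v, 'k) mpoly = "('v \<Rightarrow>\<^sub>0 nat) \<Rightarrow>\<^sub>0 'k"

definition Const :: "'k \<Rightarrow> ('v, 'k::zero) mpoly"
  where "Const q = Poly_Mapping.single 0 q"

definition Var :: "'v \<Rightarrow> ('v, 'k::zero_neq_one) mpoly"
  where "Var v = Poly_Mapping.single (Poly_Mapping.single v 1) 1"

definition is_derivation :: "(('v, 'k::comm_ring_1) mpoly \<Rightarrow> ('v, 'k) mpoly) \<Rightarrow> bool"
  where "is_derivation D \<longleftrightarrow>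
    (\<forall>u v. D (u + v) = D u + D v) \<and>
    (\<forall>q u. D (Const q * u) = Const q * D u) \<and>
    (\<forall>u v. D (u * v) = D u * v + u * D v)"

datatype letter = A | B | C

definition is_grammar_derivation :: "((letter, rat) mpoly \<Rightarrow> (letter, rat) mpoly) \<Rightarrow> bool"
  where "is_grammar_derivation D \<longleftrightarrow>
    is_derivation D \<and>
    D (Var A) = Var A * Var B \<and>
    D (Var B) = Var B ^ 2 * Var C \<and>
    D (Var C) = Var B * Var C ^ 2"

definition bessel_poly :: "nat \<Rightarrow> rat poly"
  where "bessel_poly n =
    (\<Sum>k=0..n. smult (fact (n + k) / (fact (n - k) * fact k)) ([:0, 1 / 2:] ^ k))"

definition eval_at :: "rat poly \<Rightarrow> ('v, rat) mpoly \<Rightarrow> ('v, rat) mpoly"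
  where "eval_at p u = poly (map_poly Const p) u"

text \<open>
  The derivation exists and is unique. For existence, note that it multiplies the
  monomial \<open>a\<^sup>i b\<^sup>j c\<^sup>k\<close> by the polynomial \<open>i b + (j + k) b c\<close>.
\<close>

lemma mpoly_induct [case_names single add]:
  fixes p :: "'a \<Rightarrow>\<^sub>0 'b::comm_monoid_add"
  assumes s: "\<And>m q. P (Poly_Mapping.single m q)"
    and a: "\<And>p q. P p \<Longrightarrow> P q \<Longrightarrow> P (p + q)"
  shows "P p"
proof (induction p rule: update_induct)
  case const
  show ?case using s[of undefined 0] by simp
next
  case (update f k v)
  have "Poly_Mapping.update k v f = f + Poly_Mapping.single k v"
    using update(1)
    by (intro poly_mapping_eqI)
       (auto simp: lookup_update lookup_add lookup_single when_def in_keys_iff)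
  then show ?case using a s update by simp
qed

definition log_deriv :: "(letter \<Rightarrow>\<^sub>0 nat) \<Rightarrow> (letter, rat) mpoly"
  where "log_deriv m =
    of_nat (Poly_Mapping.lookup m A) * Var B +
    of_nat (Poly_Mapping.lookup m B + Poly_Mapping.lookup m C) * (Var B * Var C)"

definition grammar_deriv :: "(letter, rat) mpoly \<Rightarrow> (letter, rat) mpoly"
  where "grammar_deriv p =
    (\<Sum>m\<in>Poly_Mapping.keys p. Poly_Mapping.single m (Poly_Mapping.lookup p m) * log_deriv m)"

lemma grammar_deriv_add: "grammar_deriv (p + q) = grammar_deriv p + grammar_deriv q"
  unfolding grammar_deriv_def
  by (rule setsum_keys_plus_distrib) (simp_all add: single_add distrib_right)

lemma grammar_deriv_single:
  "grammar_deriv (Poly_Mapping.single m q) = Poly_Mapping.single m q * log_deriv m"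
  by (cases "q = 0") (simp_all add: grammar_deriv_def)

lemma grammar_deriv_mult: "grammar_deriv (p * q) = grammar_deriv p * q + p * grammar_deriv q"
proof (induction p rule: mpoly_induct)
  case (single m r)
  show ?case
  proof (induction q rule: mpoly_induct)
    case (single k s)
    have "log_deriv (m + k) = log_deriv m + log_deriv k"
      by (simp add: log_deriv_def lookup_add algebra_simps)
    moreover have "Poly_Mapping.single (m + k) (r * s) =
        Poly_Mapping.single m r * Poly_Mapping.single k s"
      by (simp add: mult_single)
    ultimately have "grammar_deriv (Poly_Mapping.single m r * Poly_Mapping.single k s) =
        Poly_Mapping.single m r * Poly_Mapping.single k s * (log_deriv m + log_deriv k)"
      by (metis grammar_deriv_single)
    then show ?case
      by (simp add: grammar_deriv_single algebra_simps)
  next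
    case (add p q)
    then show ?case by (simp add: grammar_deriv_add algebra_simps)
  qed
next
  case (add p q)
  then show ?case by (simp add: grammar_deriv_add algebra_simps)
qed

lemma is_grammar_derivation_grammar_deriv: "is_grammar_derivation grammar_deriv"
proof -
  have "grammar_deriv (Const q * u) = Const q * grammar_deriv u" for q u
    unfolding grammar_deriv_mult
    by (simp add: Const_def grammar_deriv_single log_deriv_def)
  moreover have "grammar_deriv (Var v) = Var v * log_deriv (Poly_Mapping.single v 1)" for v
    by (simp add: Var_def grammar_deriv_single)
  ultimately show ?thesis
    by (simp add: is_grammar_derivation_def is_derivation_def grammar_deriv_add
        grammar_deriv_mult log_deriv_def lookup_single power2_eq_square mult_ac)
qed

lemma Var_power: "Var v ^ n = (Poly_Mapping.single (Poly_Mapping.single v n) 1 :: ('v, 'k::comm_ring_1) mpoly)"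
  by (induction n) (simp_all add: Var_def mult_single single_add[symmetric])

lemma single_eq_monomial:
  "(Poly_Mapping.single m q :: (letter, rat) mpoly) =
    Const q * (Var A ^ Poly_Mapping.lookup m A *
      (Var B ^ Poly_Mapping.lookup m B * Var C ^ Poly_Mapping.lookup m C))"
proof -
  have "m = Poly_Mapping.single A (Poly_Mapping.lookup m A) +
      (Poly_Mapping.single B (Poly_Mapping.lookup m B) +
       Poly_Mapping.single C (Poly_Mapping.lookup m C))"
  proof (rule poly_mapping_eqI)
    fix l
    show "Poly_Mapping.lookup m l =
      Poly_Mapping.lookup (Poly_Mapping.single A (Poly_Mapping.lookup m A) +
      (Poly_Mapping.single B (Poly_Mapping.lookup m B) +
       Poly_Mapping.single C (Poly_Mapping.lookup m C))) l"
      by (cases l) (simp_all add: lookup_add lookup_single)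
  qed
  then show ?thesis
    by (simp add: Const_def Var_power mult_single)
qed

lemma grammar_derivation_unique:
  assumes D: "is_grammar_derivation D" and E: "is_grammar_derivation E"
  shows "D = E"
proof
  note defs = is_grammar_derivation_def is_derivation_def
  have "F 1 = 0" if "is_grammar_derivation F" for F
  proof -
    have "F (1 * 1) = F 1 * 1 + 1 * F 1" using that unfolding defs by blast
    then show ?thesis by simp
  qed
  from this[OF D] this[OF E] have one: "D 1 = E 1" by simp
  have mult: "D (u * v) = E (u * v)" if "D u = E u" "D v = E v" for u v
    using D E that by (simp add: defs)
  have var: "D (Var l) = E (Var l)" for l
    using D E by (cases l) (simp_all add: defs)
  have power: "D (Var l ^ n) = E (Var l ^ n)" for l n
    by (induction n) (simp_all add: one mult var)
  fix p
  show "D p = E p"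
  proof (induction p rule: mpoly_induct)
    case (single m q)
    let ?M = "Var A ^ Poly_Mapping.lookup m A *
      (Var B ^ Poly_Mapping.lookup m B * Var C ^ Poly_Mapping.lookup m C)"
    have M: "D ?M = E ?M" by (intro mult power)
    have homog: "F (Const q * ?M) = Const q * F ?M" if "is_grammar_derivation F" for F
      using that unfolding defs by blast
    show ?case
      unfolding single_eq_monomial[of m q] homog[OF D] homog[OF E] M ..
  next
    case (add p q)
    then show ?case using D E by (simp add: defs)
  qed
qed

theorem ex1_grammar_derivation: "\<exists>!D. is_grammar_derivation D"
  using is_grammar_derivation_grammar_deriv grammar_derivation_unique by blast

end

theory Submission
  imports Defs
begin

text \<open>
  Writing \<open>D\<^sup>n(ab) = a b\<^sup>n\<^sup>+\<^sup>1 p\<^sub>n(c)\<close>, the Leibniz and chain rules give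
  \<open>p\<^sub>n\<^sub>+\<^sub>1 = (1 + (n + 1) x) p\<^sub>n + x\<^sup>2 p\<^sub>n'\<close>. Comparing coefficients, the Bessel polynomials
  satisfy the same recurrence, and both sequences start with \<open>1\<close>.
\<close>

lemma Const_add: "Const (q + r) = Const q + Const r"
  by (simp add: Const_def single_add)

lemma Const_mult: "Const (q * r) = (Const q * Const r :: ('v, 'k::comm_ring_1) mpoly)"
  by (simp add: Const_def mult_single)

lemma Const_0 [simp]: "Const 0 = 0"
  by (simp add: Const_def)

lemma Const_1 [simp]: "Const 1 = (1 :: ('v, 'k::comm_ring_1) mpoly)"
  by (simp add: Const_def)

text \<open>The factor n + 1 comes from the power rule as a natural number in the polynomial ring,
  but from the Bessel recurrence as a rational coefficient; this identifies the two.\<close>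

lemma Const_of_nat: "Const (of_nat n) = (of_nat n :: ('v, 'k::comm_ring_1) mpoly)"
  by (induction n) (simp_all add: Const_add)

lemma eval_at_0 [simp]: "eval_at 0 u = 0"
  by (simp add: eval_at_def)

lemma eval_at_pCons [simp]: "eval_at (pCons q p) u = Const q + u * eval_at p u"
  by (simp add: eval_at_def map_poly_pCons)

lemma eval_at_add: "eval_at (p + q) u = eval_at p u + eval_at q u"
  by (induction p q rule: poly_induct2) (simp_all add: Const_add algebra_simps)

lemma eval_at_smult: "eval_at (smult q p) u = Const q * eval_at p u"
  by (induction p) (simp_all add: Const_mult algebra_simps)

lemma derivation_1:
  assumes "is_derivation D"
  shows "D 1 = 0"
proof -
  have "D (1 * 1) = D 1 * 1 + 1 * D 1"
    using assms unfolding is_derivation_def by blast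
  then show ?thesis by simp
qed

lemma derivation_0:
  assumes "is_derivation D"
  shows "D 0 = 0"
proof -
  have "D (0 + 0) = D 0 + D 0"
    using assms unfolding is_derivation_def by blast
  then show ?thesis by simp
qed

lemma derivation_Const:
  assumes "is_derivation D"
  shows "D (Const q) = 0"
proof -
  have "D (Const q * 1) = Const q * D 1"
    using assms unfolding is_derivation_def by blast
  then show ?thesis using derivation_1[OF assms] by simp
qed

lemma derivation_power_Suc:
  assumes "is_derivation D"
  shows "D (u ^ Suc n) = of_nat (Suc n) * u ^ n * D u"
proof (induction n)
  case 0
  show ?case by simp
next
  case (Suc n)
  have "D (u * u ^ Suc n) = D u * u ^ Suc n + u * D (u ^ Suc n)"
    using assms unfolding is_derivation_def by blast
  then show ?case unfolding Suc by (simp add: algebra_simps)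
qed

text \<open>Chain rule, by induction along the Horner form q + u * p(u): D kills the constant q, and
  Leibniz on the product mirrors (x p)' = p + x p'.\<close>

lemma derivation_eval_at:
  assumes "is_derivation D"
  shows "D (eval_at p u) = eval_at (pderiv p) u * D u"
proof (induction p)
  case 0
  show ?case by (simp add: derivation_0[OF assms])
next
  case (pCons q p)
  have "D (Const q + u * eval_at p u) = D (Const q) + (D u * eval_at p u + u * D (eval_at p u))"
    using assms unfolding is_derivation_def by metis
  then show ?case
    by (simp add: pCons derivation_Const[OF assms] pderiv_pCons eval_at_add algebra_simps)
qed

text \<open>Each summand is a monomial, so coefficients can be read off. The case split matters: for
  k > n the truncated n - k is 0, and the quotient alone would not vanish.\<close>

lemma coeff_bessel_poly:
  "coeff (bessel_poly n) k =
    (if k \<le> n then fact (n + k) / (fact (n - k) * fact k * 2 ^ k) else 0)"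
proof -
  have "[:0, 1 / 2 :: rat:] ^ i = monom (1 / 2 ^ i) i" for i
    by (induction i) (simp_all add: monom_Suc monom_0 smult_monom)
  then show ?thesis
    by (simp add: bessel_poly_def coeff_sum if_distrib[of "(*) _"] sum.delta' cong: if_cong)
qed

lemma bessel_poly_Suc:
  "bessel_poly (Suc n) = bessel_poly n + pCons 0 (smult (of_nat (Suc n)) (bessel_poly n)) +
    pCons 0 (pCons 0 (pderiv (bessel_poly n)))"
proof (rule poly_eqI)
  fix k
  show "coeff (bessel_poly (Suc n)) k =
    coeff (bessel_poly n + pCons 0 (smult (of_nat (Suc n)) (bessel_poly n)) +
      pCons 0 (pCons 0 (pderiv (bessel_poly n)))) k"
  proof (cases k)
    case 0
    then show ?thesis by (simp add: coeff_bessel_poly)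
  next
    case (Suc j)
    \<comment> \<open>Multiplying p' by x undoes the index shift of differentiation; at j = 0 both
      sides are 0.\<close>
    have "coeff (pCons 0 (pderiv (bessel_poly n))) j = of_nat j * coeff (bessel_poly n) j"
      by (cases j) (simp_all add: coeff_pderiv)
    then have rhs: "coeff (bessel_poly n + pCons 0 (smult (of_nat (Suc n)) (bessel_poly n)) +
        pCons 0 (pCons 0 (pderiv (bessel_poly n)))) k =
      coeff (bessel_poly n) (Suc j) + of_nat (Suc (n + j)) * coeff (bessel_poly n) j"
      by (simp add: Suc algebra_simps)
    consider "j > n" | "j = n" | "j < n" by linarith
    then have "coeff (bessel_poly (Suc n)) (Suc j) =
      coeff (bessel_poly n) (Suc j) + of_nat (Suc (n + j)) * coeff (bessel_poly n) j"
    proof cases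
      case 1
      then show ?thesis by (simp add: coeff_bessel_poly)
    next
      case 2
      \<comment> \<open>The coefficient at n + 1 of \<open>bessel_poly n\<close> is 0, so the ratio
        of the two leading coefficients must be (2n+2)(2n+1) / (2(n+1)) = 2n+1, which requires
        cancelling n + 1.\<close>
      have "1 + rat_of_nat n \<noteq> 0"
        by (metis of_nat_Suc of_nat_eq_0_iff nat.distinct(1))
      with 2 show ?thesis
        by (simp add: coeff_bessel_poly divide_simps)
    next
      case 3
      \<comment> \<open>With d, the differences n - j and n - (j + 1) become d + 1 and d, so the
        factorials unfold. After removing common factors, what remains is n + j + 2 = (n - j) + 2(j
        + 1).\<close>
      then obtain d where "n = Suc (j + d)" using less_iff_Suc_add by auto
      then show ?thesis
        by (simp add: coeff_bessel_poly divide_simps) (simp add: algebra_simps)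
    qed
    then show ?thesis using rhs by (simp only: Suc)
  qed
qed

theorem theorem1:
  fixes D :: "(letter, rat) mpoly \<Rightarrow> (letter, rat) mpoly" and n :: nat
  assumes "is_grammar_derivation D"
  shows "(D ^^ n) (Var A * Var B) =
    Var A * Var B ^ (n + 1) * eval_at (bessel_poly n) (Var C)"
proof (induction n)
  case 0
  show ?case by (simp add: bessel_poly_def)
next
  case (Suc n)
  have D: "is_derivation D"
    and A: "D (Var A) = Var A * Var B"
    and B: "D (Var B) = Var B ^ 2 * Var C"
    and C: "D (Var C) = Var B * Var C ^ 2"
    using assms by (simp_all add: is_grammar_derivation_def)
  have mult: "D (u * v) = D u * v + u * D v" for u v
    using D by (simp add: is_derivation_def)
  have "(D ^^ Suc n) (Var A * Var B) =
    D (Var A * Var B ^ Suc n * eval_at (bessel_poly n) (Var C))"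
    using Suc by simp
  also have "\<dots> = Var A * Var B ^ (Suc n + 1) * eval_at (bessel_poly (Suc n)) (Var C)"
    \<comment> \<open>Every Leibniz term gains one factor b: differentiating a contributes p(c), the
      power of b contributes (n + 1) c p(c), and p(c) contributes c^2 p'(c), where p is
      \<open>bessel_poly n\<close>.\<close>
    unfolding mult derivation_power_Suc[OF D] derivation_eval_at[OF D] A B C bessel_poly_Suc
    by (simp add: eval_at_add eval_at_smult Const_add Const_of_nat power2_eq_square algebra_simps)
  finally show ?case .
qed

end
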